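(* Let $m<n$ and consider the nonlinear system $$\dot x=f(x)+g(x)u,\qquad x\in\mathbb{R}^n,\ u\in\mathbb{R}^m,$$ with $f:\mathbb{R}^n\to\mathbb{R}^n$ and $g:\mathbb{R}^n\to\mathbb{R}^{n\times m}$ smooth, $g(x)$ of full column rank for every $x$. Assume: (A1) $M\in\mathbb{R}^{n\times n}$ is a symmetric positive definite matrix such that $M\frac{\partial f}{\partial x}+\frac{\partial f}{\partial x}^\top M<0$ for all $x$; (A2) a full-rank left annihilator $g^{\perp}$ of $g$ satisfies $g^{\perp}\frac{\partial g}{\partial x}=0$. Consider the dynamic state feedback $$\dot u=\alpha u+\beta+\dot v,\qquad \alpha=-\left(g^\top g\right)^{-1}g^\top\dot g,\qquad \beta=-g^\top M\dot x,$$ with $v\in\mathbb{R}^m$. Then the system $\dot x=f(x)+g(x)u$ together with this dynamic state feedback is passive with input $\dot v$ and output $y=g^\top M\dot x$.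
   Context: A full-rank left annihilator of $g$ is a matrix $g^{\perp}(x)\in\mathbb{R}^{(n-m)\times n}$ of rank $n-m$ for every $x$ with $g^{\perp}(x)g(x)=0$; $g^{\perp}\frac{\partial g}{\partial x}=0$ means $g^{\perp}(x)\frac{\partial g}{\partial x_k}(x)=0$ for every $k$ and $x$. Here $\dot x$ stands for $f(x)+g(x)u$ and $\dot g=\sum_k\frac{\partial g}{\partial x_k}(x)\dot x_k$, so that the combined system is a system with state $(x,u)$ and external input $\dot v$ (regarded as the input signal). Passive with input $\dot v$ and output $y$ means: there exists a nonnegative differentiable storage function $V$ of the state $(x,u)$ such that $\frac{d}{dt}V\le \dot v^\top y$ along all trajectories. *)

theory Defs
  imports "HOL-Analysis.Analysis"
begin

text \<open>On a Euclidean space, \<open>C^(k+1)\<close> is equivalent to: differentiable, with all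
  directional derivatives of class \<open>C^k\<close>. Unlike iterated Frechet derivatives, this stays
  within one codomain type.\<close>

primrec Ck :: "nat \<Rightarrow> ('a::euclidean_space \<Rightarrow> 'b::real_normed_vector) \<Rightarrow> bool" where
  "Ck 0 F \<longleftrightarrow> continuous_on UNIV F"
| "Ck (Suc k) F \<longleftrightarrow>
     (\<forall>x. F differentiable (at x)) \<and> (\<forall>v. Ck k (\<lambda>x. frechet_derivative F (at x) v))"

definition smooth :: "('a::euclidean_space \<Rightarrow> 'b::real_normed_vector) \<Rightarrow> bool" where
  "smooth F \<longleftrightarrow> (\<forall>k. Ck k F)"

definition partial_deriv ::
    "(real^'n \<Rightarrow> 'b::real_normed_vector) \<Rightarrow> 'n::finite \<Rightarrow> real^'n \<Rightarrow> 'b" where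
  "partial_deriv F k x = vector_derivative (\<lambda>s. F (x + s *\<^sub>R axis k 1)) (at 0)"

definition symmetric_matrix :: "real^'n^'n \<Rightarrow> bool" where
  "symmetric_matrix A \<longleftrightarrow> transpose A = A"

definition positive_definite :: "real^'n^'n \<Rightarrow> bool" where
  "positive_definite A \<longleftrightarrow> symmetric_matrix A \<and> (\<forall>z. z \<noteq> 0 \<longrightarrow> z \<bullet> (A *v z) > 0)"

definition negative_definite :: "real^'n^'n \<Rightarrow> bool" where
  "negative_definite A \<longleftrightarrow> symmetric_matrix A \<and> (\<forall>z. z \<noteq> 0 \<longrightarrow> z \<bullet> (A *v z) < 0)"

text \<open>Matrices with \<open>n\<close> rows and \<open>m\<close> columns have type \<^typ>\<open>real^'m^'n\<close>; in particular the
  type of \<open>gp x\<close> below is that of an \<open>(n - m) \<times> n\<close> matrix as soon as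
  \<open>CARD('k) = CARD('n) - CARD('m)\<close>.\<close>

definition full_rank_left_annihilator ::
    "(real^'n \<Rightarrow> real^'n^'k) \<Rightarrow> (real^'n \<Rightarrow> real^'m^'n) \<Rightarrow> bool" where
  "full_rank_left_annihilator gp g \<longleftrightarrow>
     CARD('k) = CARD('n) - CARD('m) \<and> (\<forall>x. rank (gp x) = CARD('k) \<and> gp x ** g x = 0)"

text \<open>Trajectories of \<open>z' = F(z, w)\<close> are classical solutions on an arbitrary time interval
  (derivatives are one-sided at end points belonging to it), for an arbitrary input signal.\<close>

definition is_trajectory ::
    "('s::real_normed_vector \<Rightarrow> 'i \<Rightarrow> 's) \<Rightarrow> real set \<Rightarrow> (real \<Rightarrow> 'i) \<Rightarrow> (real \<Rightarrow> 's) \<Rightarrow> bool" where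
  "is_trajectory F T w z \<longleftrightarrow>
     is_interval T \<and> (\<forall>t\<in>T. (z has_vector_derivative F (z t) (w t)) (at t within T))"

definition passive_system ::
    "('s::real_normed_vector \<Rightarrow> 'i::real_inner \<Rightarrow> 's) \<Rightarrow> ('s \<Rightarrow> 'i) \<Rightarrow> bool" where
  "passive_system F h \<longleftrightarrow>
     (\<exists>V :: 's \<Rightarrow> real.
        (\<forall>z. 0 \<le> V z) \<and> (\<forall>z. V differentiable (at z)) \<and>
        (\<forall>T w z. is_trajectory F T w z \<longrightarrow>
           (\<forall>t\<in>T. \<exists>D. ((\<lambda>s. V (z s)) has_real_derivative D) (at t within T) \<and>
                      D \<le> w t \<bullet> h (z t))))"

definition xdot ::
    "(real^'n \<Rightarrow> real^'n) \<Rightarrow> (real^'n \<Rightarrow> real^'m^'n) \<Rightarrow> real^'n \<Rightarrow> real^'m \<Rightarrow> real^'n" where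
  "xdot f g x u = f x + g x *v u"

definition gdot ::
    "(real^'n \<Rightarrow> real^'n) \<Rightarrow> (real^'n \<Rightarrow> real^'m^'n) \<Rightarrow> real^'n \<Rightarrow> real^'m \<Rightarrow> real^'m^'n" where
  "gdot f g x u = (\<Sum>k\<in>UNIV. (xdot f g x u $ k) *\<^sub>R partial_deriv g k x)"

definition feedback_alpha ::
    "(real^'n \<Rightarrow> real^'n) \<Rightarrow> (real^'n \<Rightarrow> real^'m^'n) \<Rightarrow> real^'n \<Rightarrow> real^'m \<Rightarrow> real^'m^'m" where
  "feedback_alpha f g x u =
     - (matrix_inv (transpose (g x) ** g x) ** transpose (g x) ** gdot f g x u)"

definition feedback_beta ::
    "(real^'n \<Rightarrow> real^'n) \<Rightarrow> (real^'n \<Rightarrow> real^'m^'n) \<Rightarrow> real^'n^'n \<Rightarrow>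
     real^'n \<Rightarrow> real^'m \<Rightarrow> real^'m" where
  "feedback_beta f g M x u = - (transpose (g x) *v (M *v xdot f g x u))"

text \<open>The state is the pair \<open>(x, u)\<close>; the argument \<open>vdot\<close> is the value of the external input.\<close>

definition closed_loop ::
    "(real^'n \<Rightarrow> real^'n) \<Rightarrow> (real^'n \<Rightarrow> real^'m^'n) \<Rightarrow> real^'n^'n \<Rightarrow>
     (real^'n) \<times> (real^'m) \<Rightarrow> real^'m \<Rightarrow> (real^'n) \<times> (real^'m)" where
  "closed_loop f g M = (\<lambda>(x, u) vdot.
     (xdot f g x u, feedback_alpha f g x u *v u + feedback_beta f g M x u + vdot))"

definition closed_loop_output ::
    "(real^'n \<Rightarrow> real^'n) \<Rightarrow> (real^'n \<Rightarrow> real^'m^'n) \<Rightarrow> real^'n^'n \<Rightarrow>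
     (real^'n) \<times> (real^'m) \<Rightarrow> real^'m" where
  "closed_loop_output f g M = (\<lambda>(x, u). transpose (g x) *v (M *v xdot f g x u))"

end

theory Submission imports Defs begin

text \<open>The storage function is \<open>V (x, u) = 1/2 xdot\<^sup>T M xdot\<close>, a Krasovskii-type Lyapunov function.
  By (A2) the columns of \<open>gdot\<close> lie in the kernel of \<open>gperp\<close>, which for dimension reasons is the
  column space of \<open>g\<close>; since \<open>g (g\<^sup>T g)\<^sup>-\<^sup>1 g\<^sup>T\<close> projects onto that space, \<open>g \<alpha> = - gdot\<close>.
  Hence along trajectories \<open>xdot\<close> has derivative \<open>J xdot + g (\<beta> + vdot)\<close> with \<open>J\<close> the Jacobian
  of \<open>f\<close>, and the derivative of \<open>V\<close> is
  \<open>1/2 xdot\<^sup>T (M J + J\<^sup>T M) xdot - |y|\<^sup>2 + vdot\<^sup>T y\<close>.\<close>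

lemma transpose_matrix_vector_adjoint:
  fixes A :: "real^'m^'n"
  shows "(transpose A *v x) \<bullet> y = x \<bullet> (A *v y)"
  by (simp add: dot_lmul_matrix)

lemma bounded_bilinear_matrix_vector_mult:
  "bounded_bilinear (\<lambda>(A :: real^'m^'n) x. A *v x)"
proof -
  have "bilinear (\<lambda>(A :: real^'m^'n) x. A *v x)"
    unfolding bilinear_def
    by (auto intro!: linearI simp: matrix_vector_right_distrib matrix_vector_mult_add_rdistrib
        scaleR_matrix_vector_assoc matrix_vector_mult_scaleR)
  then show ?thesis
    by (simp add: bilinear_conv_bounded_bilinear)
qed

text \<open>Rank-nullity by orthogonality: the null space of \<open>B\<close> is the orthogonal
  complement of its row space, the range of \<open>transpose B\<close>, whose dimension is
  \<open>rank B\<close>.\<close>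

lemma dim_null_space:
  fixes B :: "real^'n^'k"
  shows "dim {y. B *v y = 0} + rank B = CARD('n)"
proof -
  let ?R = "range ((*v) (transpose B))"
  have "{y. B *v y = 0} = {y \<in> UNIV. \<forall>x\<in>?R. orthogonal x y}"
    \<comment> \<open>From right to left, testing against \<open>x = B *v y\<close> gives |B y|^2 =
      0.\<close>
    by (auto simp: orthogonal_def transpose_matrix_vector_adjoint simp del: transpose_matrix_vector)
      (metis inner_eq_zero_iff)
  moreover have "dim {y \<in> UNIV. \<forall>x\<in>?R. orthogonal x y} + dim ?R = dim (UNIV :: (real^'n) set)"
    by (intro dim_subspace_orthogonal_to_vectors linear_subspace_image matrix_vector_mul_linear) auto
  ultimately show ?thesis
    using rank_dim_range[of "transpose B"] by (simp add: rank_transpose del: transpose_matrix_vector)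
qed

text \<open>\<open>B ** A = 0\<close> gives one inclusion; the rank condition makes the dimensions
  of the two subspaces agree, which turns it into equality.\<close>

lemma null_space_eq_column_space:
  fixes A :: "real^'m^'n" and B :: "real^'n^'k"
  assumes "B ** A = 0" "rank A + rank B = CARD('n)"
  shows "{y. B *v y = 0} = range ((*v) A)"
proof -
  have sub: "range ((*v) A) \<subseteq> {y. B *v y = 0}"
    using assms(1) by (auto simp: matrix_vector_mul_assoc)
  have "subspace {y. B *v y = 0}"
    by (auto intro!: subspaceI simp: matrix_vector_right_distrib matrix_vector_mult_scaleR)
  moreover have "subspace (range ((*v) A))"
    by (intro linear_subspace_image matrix_vector_mul_linear) auto
  moreover have "dim {y. B *v y = 0} \<le> dim (range ((*v) A))"
    using dim_null_space[of B] assms(2) by (simp add: rank_dim_range)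
  ultimately show ?thesis
    using subspace_dim_equal sub by metis
qed

text \<open>If the Gram matrix kills \<open>z\<close>, then |A z|^2 = 0, and full column rank makes
  \<open>A\<close> injective. For a square matrix a trivial kernel suffices.\<close>

lemma invertible_gram_matrix:
  fixes A :: "real^'m^'n"
  assumes "rank A = CARD('m)"
  shows "invertible (transpose A ** A)"
proof -
  have "z = 0" if "(transpose A ** A) *v z = 0" for z
  proof -
    have "(A *v z) \<bullet> (A *v z) = (transpose A *v (A *v z)) \<bullet> z"
      by (metis transpose_matrix_vector_adjoint inner_commute)
    also have "\<dots> = 0"
      using that by (metis matrix_vector_mul_assoc inner_zero_left)
    finally have "A *v z = 0" by simp
    with assms show "z = 0"
      using matrix_nonfull_linear_equations_eq by blast
  qed
  then show ?thesis
    by (metis invertible_left_inverse matrix_left_invertible_ker)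
qed

lemma matrix_inv_left:
  assumes "invertible A"
  shows "matrix_inv A ** A = mat 1"
  using someI_ex[OF assms[unfolded invertible_def]] by (simp add: matrix_inv_def)

lemma projection_column_space:
  fixes A :: "real^'m^'n"
  assumes "rank A = CARD('m)" "y \<in> range ((*v) A)"
  shows "A *v ((matrix_inv (transpose A ** A) ** transpose A) *v y) = y"
proof -
  let ?P = "matrix_inv (transpose A ** A)"
  from assms(2) obtain p where p: "y = A *v p" by blast
  have "(?P ** transpose A) *v y = (?P ** (transpose A ** A)) *v p"
    by (simp add: p matrix_vector_mul_assoc matrix_mul_assoc)
  also have "\<dots> = p"
    using invertible_gram_matrix[OF assms(1)] by (simp add: matrix_inv_left)
  finally show ?thesis
    using p by simp
qed

text \<open>Links the coordinate sum that defines \<open>gdot\<close> with the derivative that the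
  chain rule produces.\<close>

lemma frechet_derivative_partial_deriv:
  fixes g :: "real^'n \<Rightarrow> 'b::real_normed_vector"
  assumes "g differentiable (at x)"
  shows "frechet_derivative g (at x) h = (\<Sum>k\<in>UNIV. (h $ k) *\<^sub>R partial_deriv g k x)"
proof -
  let ?D = "frechet_derivative g (at x)"
  have D: "(g has_derivative ?D) (at x)"
    using assms by (simp add: frechet_derivative_works)
  have lin: "linear ?D"
    using D has_derivative_linear by blast
  have p: "partial_deriv g k x = ?D (axis k 1)" for k
  proof -
    have "((\<lambda>s. g (x + s *\<^sub>R axis k 1)) has_derivative (\<lambda>s. ?D (s *\<^sub>R axis k 1))) (at 0)"
      by (rule has_derivative_compose[where f = "\<lambda>s. x + s *\<^sub>R axis k 1" and g = g])
         (auto intro!: derivative_eq_intros D)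
    then have "((\<lambda>s. g (x + s *\<^sub>R axis k 1)) has_vector_derivative ?D (axis k 1)) (at 0)"
      by (simp add: has_vector_derivative_def linear_scale[OF lin])
    then show ?thesis
      unfolding partial_deriv_def by (rule vector_derivative_at)
  qed
  have "?D h = ?D (\<Sum>k\<in>UNIV. (h $ k) *\<^sub>R axis k 1)"
    using basis_expansion[of h] by (simp add: scalar_mult_eq_scaleR)
  also have "\<dots> = (\<Sum>k\<in>UNIV. (h $ k) *\<^sub>R partial_deriv g k x)"
    by (simp add: linear_sum[OF lin] linear_scale[OF lin] p)
  finally show ?thesis .
qed

lemma smooth_imp_differentiable:
  assumes "smooth F" shows "F differentiable (at x)"
  using assms unfolding smooth_def by (metis Ck.simps(2))

lemma xdot_has_derivative:
  fixes g :: "real^'n \<Rightarrow> real^'m^'n"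
  assumes "f differentiable (at x)" "g differentiable (at x)"
  shows "((\<lambda>(x, u). xdot f g x u) has_derivative
    (\<lambda>(dx, du). jacobian f (at x) *v dx + (frechet_derivative g (at x) dx *v u + g x *v du)))
    (at (x, u))"
proof -
  have f: "(f has_derivative (*v) (jacobian f (at x))) (at x)"
    using assms(1) by (simp add: jacobian_works)
  have g: "(g has_derivative frechet_derivative g (at x)) (at x)"
    using assms(2) by (simp add: frechet_derivative_works)
  have "((\<lambda>z. f (fst z)) has_derivative (\<lambda>z. jacobian f (at x) *v fst z)) (at (x, u))"
    by (rule has_derivative_compose[where f = fst and g = f])
       (use f in \<open>auto intro!: derivative_eq_intros\<close>)
  moreover have g': "((\<lambda>z. g (fst z)) has_derivative
      (\<lambda>z. frechet_derivative g (at x) (fst z))) (at (x, u))"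
    by (rule has_derivative_compose[where f = fst and g = g])
       (use g in \<open>auto intro!: derivative_eq_intros\<close>)
  then have "((\<lambda>z. g (fst z) *v snd z) has_derivative
      (\<lambda>z. g x *v snd z + frechet_derivative g (at x) (fst z) *v u)) (at (x, u))"
    using bounded_bilinear.FDERIV[OF bounded_bilinear_matrix_vector_mult g'
        has_derivative_snd[OF has_derivative_ident]] by simp
  ultimately show ?thesis
    unfolding xdot_def case_prod_unfold
    by (auto dest: has_derivative_add simp: add_ac)
qed

text \<open>Symmetry of \<open>M\<close> makes the two terms of the product rule equal, which
  absorbs the factor 1/2.\<close>

lemma half_quadratic_form_has_derivative:
  fixes W :: "'a::real_normed_vector \<Rightarrow> real^'n"
  assumes "symmetric_matrix M" "(W has_derivative W') (at z within S)"
  shows "((\<lambda>z. (W z \<bullet> (M *v W z)) / 2) has_derivative (\<lambda>h. (M *v W z) \<bullet> W' h)) (at z within S)"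
proof -
  have M: "a \<bullet> (M *v b) = (M *v a) \<bullet> b" for a b
    using transpose_matrix_vector_adjoint[of M a b] assms(1) by (simp add: symmetric_matrix_def del: transpose_matrix_vector)
  have MW: "((\<lambda>z. M *v W z) has_derivative (\<lambda>h. M *v W' h)) (at z within S)"
    using assms(2) by (rule bounded_linear.has_derivative[OF matrix_vector_mul_bounded_linear])
  have "((\<lambda>z. (W z \<bullet> (M *v W z)) / 2) has_derivative
      (\<lambda>h. (W z \<bullet> (M *v W' h) + W' h \<bullet> (M *v W z)) / 2)) (at z within S)"
    by (intro bounded_linear.has_derivative[OF bounded_linear_divide] has_derivative_inner assms(2) MW)
  moreover have "W z \<bullet> (M *v W' h) + W' h \<bullet> (M *v W z) = 2 * ((M *v W z) \<bullet> W' h)" for h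
    using M[of "W z" "W' h"] inner_commute[of "W' h" "M *v W z"] by linarith
  ultimately show ?thesis
    by simp
qed

text \<open>\<open>gdot\<close> is a linear combination of the partial derivatives of
  \<open>g\<close>, each annihilated by \<open>gperp x\<close>. Since m < n, the truncated
  difference n - m is the true one, so the ranks of \<open>g x\<close> and \<open>gperp x\<close>
  add up to n.\<close>

lemma gdot_in_column_space:
  fixes g :: "real^'n \<Rightarrow> real^'m^'n" and gperp :: "real^'n \<Rightarrow> real^'n^'k"
  assumes "CARD('m) < CARD('n)" "rank (g x) = CARD('m)"
    and "full_rank_left_annihilator gperp g"
    and "\<And>k. gperp x ** partial_deriv g k x = 0"
  shows "gdot f g x u *v w \<in> range ((*v) (g x))"
proof -
  have "gperp x *v (gdot f g x u *v w) = 0"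
    by (simp add: gdot_def bounded_bilinear.sum_left[OF bounded_bilinear_matrix_vector_mult]
        bounded_bilinear.sum_right[OF bounded_bilinear_matrix_vector_mult]
        scaleR_matrix_vector_assoc[symmetric] matrix_vector_mult_scaleR
        matrix_vector_mul_assoc assms(4))
  moreover have "{y. gperp x *v y = 0} = range ((*v) (g x))"
    using assms(1-3) by (intro null_space_eq_column_space) (auto simp: full_rank_left_annihilator_def)
  ultimately show ?thesis by blast
qed

lemma feedback_alpha_cancels_gdot:
  assumes "rank (g x) = CARD('m)" "gdot f g x u *v w \<in> range ((*v) (g x))"
  shows "g x *v (feedback_alpha f g x u *v w) = - (gdot f g x u *v (w :: real^'m))"
  using projection_column_space[OF assms]
  by (simp add: feedback_alpha_def matrix_vector_mul_assoc matrix_mul_assoc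
      bounded_bilinear.minus_left[OF bounded_bilinear_matrix_vector_mult]
      bounded_bilinear.minus_right[OF bounded_bilinear_matrix_vector_mult])

text \<open>Both summands of the symmetrized matrix contribute the same number
  \<open>(M *v a) \<bullet> (J *v a)\<close> to its quadratic form at \<open>a\<close>.\<close>

lemma symmetrized_negative_imp_inner_nonpos:
  assumes "symmetric_matrix M" "negative_definite (M ** J + transpose J ** M)"
  shows "(M *v a) \<bullet> (J *v a) \<le> 0"
proof -
  have "a \<bullet> ((M ** J + transpose J ** M) *v a) = 2 * ((M *v a) \<bullet> (J *v a))"
  proof -
    have "a \<bullet> (M *v (J *v a)) = (M *v a) \<bullet> (J *v a)"
      using transpose_matrix_vector_adjoint[of M a "J *v a"] assms(1)
      by (simp add: symmetric_matrix_def del: transpose_matrix_vector)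
    moreover have "a \<bullet> (transpose J *v (M *v a)) = (M *v a) \<bullet> (J *v a)"
      using transpose_matrix_vector_adjoint[of J "M *v a" a] by (metis inner_commute)
    ultimately show ?thesis
      by (simp add: matrix_vector_mult_add_rdistrib inner_add_right
          matrix_vector_mul_assoc[symmetric] del: transpose_matrix_vector)
  qed
  then show ?thesis
    using assms(2) unfolding negative_definite_def
    by (cases "a = 0") (simp, fastforce)
qed

theorem theorem2p9:
  fixes f :: "real^'n \<Rightarrow> real^'n"
    and g :: "real^'n \<Rightarrow> real^'m^'n"
    and gperp :: "real^'n \<Rightarrow> real^'n^'k"
    and M :: "real^'n^'n"
  assumes "CARD('m) < CARD('n)"
    and "smooth f"
    and "smooth g"
    and "\<And>x. rank (g x) = CARD('m)"
    and "positive_definite M"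
    and "\<And>x. negative_definite (M ** jacobian f (at x) + transpose (jacobian f (at x)) ** M)"
    and "full_rank_left_annihilator gperp g"
    and "\<And>k x. gperp x ** partial_deriv g k x = 0"
  shows "passive_system (closed_loop f g M) (closed_loop_output f g M)"
proof -
  define W where "W = (\<lambda>(x, u). xdot f g x u)"
  define W' where "W' = (\<lambda>(x, u) (dx, du).
    jacobian f (at x) *v dx + (frechet_derivative g (at x) dx *v u + g x *v du))"
  define V where "V = (\<lambda>z. (W z \<bullet> (M *v W z)) / 2)"
  have sym: "symmetric_matrix M"
    using assms(5) by (simp add: positive_definite_def)
  have dg: "g differentiable (at x)" for x
    using assms(3) by (rule smooth_imp_differentiable)
  have dW: "(W has_derivative W' z) (at z)" for z
    using xdot_has_derivative[OF smooth_imp_differentiable[OF assms(2)] dg, of "fst z" "snd z"]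
    by (simp add: W_def W'_def case_prod_unfold)
  have dV: "(V has_derivative (\<lambda>h. (M *v W z) \<bullet> W' z h)) (at z)" for z
    unfolding V_def using sym dW by (rule half_quadratic_form_has_derivative)
  have linV: "linear (\<lambda>h. (M *v W z) \<bullet> W' z h)" for z
    using dV has_derivative_linear by blast
  have nonneg: "0 \<le> V z" for z
    using assms(5) unfolding V_def positive_definite_def by (cases "W z = 0") (auto intro: less_imp_le)
  have dissipation: "(M *v W z) \<bullet> W' z (closed_loop f g M z w) \<le> w \<bullet> closed_loop_output f g M z" for z w
  proof -
    obtain x u where z: "z = (x, u)" by (cases z)
    define a where "a = xdot f g x u"
    define y where "y = transpose (g x) *v (M *v a)"
    \<comment> \<open>The \<open>x\<close>-component of the closed-loop vector field is
      \<open>a\<close>, so \<open>g\<close> changes along trajectories at the rate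
      \<open>gdot\<close>.\<close>
    have gd: "frechet_derivative g (at x) a = gdot f g x u"
      by (simp add: frechet_derivative_partial_deriv[OF dg] gdot_def a_def)
    have "g x *v (feedback_alpha f g x u *v u) = - (gdot f g x u *v u)"
      using assms by (intro feedback_alpha_cancels_gdot gdot_in_column_space) auto
    \<comment> \<open>The \<open>feedback_alpha\<close> term cancels
      \<open>gdot f g x u *v u\<close>; \<open>feedback_beta\<close> equals \<open>- y\<close>, so
      only \<open>w - y\<close> still acts through \<open>g x\<close>.\<close>
    then have "W' z (closed_loop f g M z w) = jacobian f (at x) *v a + g x *v (w - y)"
      by (simp add: z W'_def closed_loop_def feedback_beta_def matrix_vector_right_distrib gd
          matrix_vector_mult_diff_distrib y_def
          bounded_bilinear.minus_right[OF bounded_bilinear_matrix_vector_mult]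
          flip: a_def del: transpose_matrix_vector)
    \<comment> \<open>Moving \<open>g x\<close> across the inner product produces exactly the output
      \<open>y\<close>.\<close>
    moreover have "(M *v a) \<bullet> (g x *v (w - y)) = y \<bullet> (w - y)"
      by (simp only: y_def transpose_matrix_vector_adjoint)
    moreover have "(M *v a) \<bullet> (jacobian f (at x) *v a) \<le> 0"
      using sym assms(6) by (rule symmetrized_negative_imp_inner_nonpos)
    moreover have "closed_loop_output f g M z = y" "W z = a"
      by (simp_all add: z closed_loop_output_def y_def a_def W_def)
    \<comment> \<open>The surplus -|y|^2 contributed by \<open>feedback_beta\<close> is dropped
      here.\<close>
    moreover have "y \<bullet> (w - y) \<le> w \<bullet> y"
      by (simp add: inner_diff_right inner_commute)
    ultimately show ?thesis
      by (simp add: inner_add_right)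
  qed
  have "\<exists>D. ((\<lambda>s. V (z s)) has_real_derivative D) (at t within T)
      \<and> D \<le> w t \<bullet> closed_loop_output f g M (z t)"
    if "is_trajectory (closed_loop f g M) T w z" "t \<in> T" for T w z t
  proof -
    let ?F = "closed_loop f g M (z t) (w t)"
    have "(z has_derivative (\<lambda>h. h *\<^sub>R ?F)) (at t within T)"
      using that unfolding is_trajectory_def has_vector_derivative_def by blast
    \<comment> \<open>\<open>V\<close> is differentiable on the whole state space, so the chain rule
      also covers one-sided derivatives at end points of \<open>T\<close>; \<open>linV\<close> pulls
      the time increment out as a scalar factor.\<close>
    from has_derivative_compose[OF this dV]
    have "((\<lambda>s. V (z s)) has_real_derivative (M *v W (z t)) \<bullet> W' (z t) ?F) (at t within T)"
      unfolding has_field_derivative_def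
      by (rule has_derivative_eq_rhs) (auto simp: linear_scale[OF linV])
    then show ?thesis
      using dissipation by blast
  qed
  then show ?thesis
    unfolding passive_system_def using nonneg differentiableI[OF dV] by blast
qed

end
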